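(* Let $G=(V,E)$ be an undirected graph and let $f^*:V\to\{0,1\}$ be the target labeling. Let $G^+$ denote the induced subgraph of $G$ on the vertices $x\in V$ with $f^*(x)=1$, and let $S^+$ be a dominating set of $G^+$. Then $\mathrm{Loss}(x;h_{S^+},f^* )=0$ for every $x\in V$, where $h_{S^+}(x)=\mathbb{I}\{x\in S^+\}$.
   Context: A dominating set of a graph is a subset $S$ of its vertices such that every vertex is in $S$ or adjacent to a vertex of $S$. The improvement set of $x\in V$ is its neighborhood in $G$: $\Delta(x)=\{x'\in V:(x,x')\in E\}$. For a classifier $h:V\to\{0,1\}$ the reaction set of $x$ is: $\Delta_h(x)=\{x\}$ if $h(x)=1$; $\Delta_h(x)=\{x\}$ if $\{x'\in\Delta(x): h(x')=1\}=\emptyset$; and $\Delta_h(x)=\{x'\in\Delta(x):h(x')=1\}$ otherwise. $\mathrm{Loss}(x;h,f^* )=\max_{x'\in\Delta_h(x)}\mathbb{I}[h(x')\neq f^*(x')]$. *)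

theory Defs
  imports "Graph_Theory.Graph_Theory" "HOL-Library.FuncSet" "HOL-Library.Indicator_Function"
begin

text \<open>
  An undirected graph $G = (V, E)$ is a symmetric digraph without parallel arcs, i.e. a
  \<^typ>\<open>'a pair_pre_digraph\<close> satisfying \<^locale>\<open>pair_sym_digraph\<close>, with
  $V$ = \<open>pverts G\<close> and $E$ = \<open>parcs G\<close>. Neither finiteness nor
  absence of loops is assumed. Binary labels are natural numbers in \<open>{0, 1}\<close>.
\<close>

definition dominating_set :: "('a, 'b) pre_digraph \<Rightarrow> 'a set \<Rightarrow> bool" where
  "dominating_set H S \<longleftrightarrow>
     S \<subseteq> verts H \<and> (\<forall>v \<in> verts H. v \<in> S \<or> (\<exists>u \<in> S. v \<rightarrow>\<^bsub>H\<^esub> u))"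

definition improvement_set :: "'a pair_pre_digraph \<Rightarrow> 'a \<Rightarrow> 'a set" where
  "improvement_set G x = {x' \<in> pverts G. (x, x') \<in> parcs G}"

definition reaction_set :: "'a pair_pre_digraph \<Rightarrow> ('a \<Rightarrow> nat) \<Rightarrow> 'a \<Rightarrow> 'a set" where
  "reaction_set G h x =
     (if h x = 1 then {x}
      else if {x' \<in> improvement_set G x. h x' = 1} = {} then {x}
      else {x' \<in> improvement_set G x. h x' = 1})"

text \<open>
  The maximum ranges over a nonempty subset of \<open>{0, 1}\<close>, so \<^const>\<open>Max\<close> is meaningful
  even when the reaction set is infinite.
\<close>

definition Loss :: "'a pair_pre_digraph \<Rightarrow> 'a \<Rightarrow> ('a \<Rightarrow> nat) \<Rightarrow> ('a \<Rightarrow> nat) \<Rightarrow> nat" where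
  "Loss G x h f = (MAX x' \<in> reaction_set G h x. of_bool (h x' \<noteq> f x'))"

definition positive_subgraph :: "'a pair_pre_digraph \<Rightarrow> ('a \<Rightarrow> nat) \<Rightarrow> ('a, 'a \<times> 'a) pre_digraph" where
  "positive_subgraph G f = with_proj G \<restriction> {x \<in> pverts G. f x = 1}"

definition set_classifier :: "'a set \<Rightarrow> 'a \<Rightarrow> nat" where
  "set_classifier S = indicator S"

end

theory Submission
  imports Defs
begin

text \<open>Every possible reaction is classified correctly. A reaction in \<open>S\<close> is truly
  positive, as \<open>S\<close> lies in the positive subgraph. A reaction outside \<open>S\<close>
  can only be \<open>x\<close> staying put for want of a neighbor in \<open>S\<close>; were
  \<open>x\<close> positive, domination would supply such a neighbor, so \<open>x\<close> is truly
  negative.\<close>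

lemma verts_positive_subgraph: "verts (positive_subgraph G f) = {x \<in> pverts G. f x = 1}"
  by (simp add: positive_subgraph_def)

text \<open>Carries a dominating neighbor back to \<open>G\<close>, where reactions take
  place.\<close>

lemma positive_subgraph_dominates_imp_parcs:
  assumes "x \<rightarrow>\<^bsub>positive_subgraph G f\<^esub> u"
  shows "(x, u) \<in> parcs G"
  using assms by (auto simp: positive_subgraph_def arcs_ends_def arc_to_ends_def)

lemma reaction_set_nonempty: "reaction_set G h x \<noteq> {}"
  by (auto simp: reaction_set_def)

text \<open>Nonemptiness of the reaction set matters: it makes the image exactly \<open>{0}\<close>,
  whereas \<open>Max\<close> of the empty set is unspecified.\<close>

lemma Loss_eq_0:
  assumes "\<And>x'. x' \<in> reaction_set G h x \<Longrightarrow> h x' = f x'"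
  shows "Loss G x h f = 0"
proof -
  have "(\<lambda>x'. of_bool (h x' \<noteq> f x') :: nat) ` reaction_set G h x = {0}"
    using assms reaction_set_nonempty[of G h x] by force
  then show ?thesis by (simp add: Loss_def)
qed

theorem theorem5p2:
  fixes G :: "'a pair_pre_digraph" and fstar :: "'a \<Rightarrow> nat" and S :: "'a set"
  assumes "pair_sym_digraph G"
    and "fstar \<in> pverts G \<rightarrow> {0, 1}"
    and "dominating_set (positive_subgraph G fstar) S"
  shows "\<forall>x \<in> pverts G. Loss G x (set_classifier S) fstar = 0"
proof (intro ballI Loss_eq_0)
  fix x x'
  assume x: "x \<in> pverts G" and x': "x' \<in> reaction_set G (set_classifier S) x"
  have pos: "u \<in> pverts G" "fstar u = 1" if "u \<in> S" for u
    using assms(3) that by (auto simp: dominating_set_def verts_positive_subgraph)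
  show "set_classifier S x' = fstar x'"
  proof (cases "x' \<in> S")
    case True
    then show ?thesis by (simp add: set_classifier_def pos)
  next
    case False
    \<comment> \<open>Two of the three branches of \<open>reaction_set\<close> yield only points of
      \<open>S\<close>, so the middle one applies. \<open>pos(1)\<close> places each
      \<open>u\<close> in \<open>pverts G\<close>, as \<open>improvement_set\<close>
      demands.\<close>
    then have "x' = x" and isolated: "\<forall>u \<in> S. (x, u) \<notin> parcs G"
      using x' pos(1)
      by (auto simp: reaction_set_def improvement_set_def set_classifier_def indicator_def
          split: if_splits)
    have "fstar x \<noteq> 1"
    proof
      assume "fstar x = 1"
      with x False \<open>x' = x\<close> assms(3) obtain u where "u \<in> S" "x \<rightarrow>\<^bsub>positive_subgraph G fstar\<^esub> u"
        by (auto simp: dominating_set_def verts_positive_subgraph)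
      with isolated show False by (blast dest: positive_subgraph_dominates_imp_parcs)
    qed
    \<comment> \<open>Labels are naturals, so binarity of \<open>fstar\<close> is what turns
      \<noteq> 1 into 0.\<close>
    then have "fstar x = 0" using assms(2) x by auto
    with False \<open>x' = x\<close> show ?thesis by (simp add: set_classifier_def)
  qed
qed

end
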